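(* Let $\lambda_0\in\mathbb{R}$. If an approximate design $d$ with $P_d=(p_s)_{s\in{\cal S}}$ satisfies $$\sum_{s\in{\cal R}}p_s[\hat A_{s11}+x_0\hat A_{s12}]=\frac{y_0}{t-1}B_t,\qquad \sum_{s\in{\cal R}}p_s[\hat A_{s21}+x_0\hat A_{s22}]=0,$$ $$\sum_{s\in{\cal R}}p_s\tilde B\,[F_s+x_0(T_s+\lambda_0F_s)]B_t=0,\qquad \sum_{s\in{\cal R}}p_s=1,\qquad p_s=0\ \text{ if } s\notin{\cal R},$$ then for every exchangeable prior distribution $g$ of $\tau_0$, $d$ maximizes $\varphi_{g,\lambda_0}$ over all approximate designs.
   Context: Fix integers $p\ge2$ (periods), $t\ge2$ (treatments), $n\ge1$ (subjects) and a symmetric positive definite real $p\times p$ matrix $\Sigma$ (within-subject covariance). $1_k$ is the all-ones vector of length $k$, $J_k=1_k1_k'$, $B_k=I_k-J_k/k$, prime denotes transpose, and $\tilde B=\Sigma^{-1}-\Sigma^{-1}J_p\Sigma^{-1}/(1_p'\Sigma^{-1}1_p)$. Let ${\cal S}=\{1,\dots,t\}^p$ be the set of treatment sequences. For $s=(t_1,\dots,t_p)\in{\cal S}$, $T_s$ is the $p\times t$ matrix with $(k,i)$ entry $1$ if $t_k=i$ and $0$ otherwise; $F_s$ is the $p\times t$ matrix with zero first row and, for $k\ge2$, $(k,i)$ entry $1$ if $t_{k-1}=i$ and $0$ otherwise. An (approximate) design $d$ is a vector $P_d=(p_s)_{s\in{\cal S}}$ with $p_s\ge0$, $\sum_sp_s=1$.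 For $1\le i,j\le2$ put $\hat A_{sij}=B_tG_{s,i}'\tilde BG_{s,j}B_t$ with $G_{s,1}=F_s$, $G_{s,2}=T_s+\lambda_0F_s$; $\hat A_{dij}=n\sum_sp_s\hat A_{sij}$; $A_{dij}=\hat A_{dij}-nG_i'\tilde BG_j$ with $G_1=\sum_sp_sF_sB_t$, $G_2=\sum_sp_s(T_s+\lambda_0F_s)B_t$; and $A_d=A_{d11}-A_{d12}A_{d22}^-A_{d21}$ ($^-$ denotes a generalized inverse); $A_d$ is nonnegative definite. In the proportional model (carryover effects equal $\lambda$ times direct effects $\tau$), the information for $\lambda$ at $(\tau_0,\lambda_0)$ is $\tau_0'A_d\tau_0$. A prior $g$ is a probability distribution on $\{\tau_0\in\mathbb{R}^t:1_t'\tau_0=0,\ \tau_0\neq0\}$, exchangeable if invariant under all permutations of coordinates, and $\varphi_{g,\lambda_0}(d)=\mathbb{E}_g[\tau_0'A_d\tau_0]\in[0,\infty]$. Let $h_{sij}=\mathrm{tr}(\hat A_{sij})$, $r_s(x)=h_{s11}+2h_{s12}x+h_{s22}x^2$, $r(x)=\max_{s\in{\cal S}}r_s(x)$, $y_0=\min_{x\in\mathbb{R}}r(x)$; $x_0$ is the solution of $r(x)=y_0$, which is taken (standing assumption) to be unique; ${\cal R}=\{s\in{\cal S}:r_s(x_0)=y_0\}$. *)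

theory Defs
  imports "HOL-Analysis.Analysis" "HOL-Probability.Probability"
begin

text \<open>
  Periods are the elements of a finite linearly ordered type \<open>'p\<close>, listed in increasing order, and
  treatments are the elements of a finite type \<open>'t\<close>; so \<open>CARD('p)\<close> and \<open>CARD('t)\<close> are the numbers
  of periods and treatments, a treatment sequence is a function \<open>'p \<Rightarrow> 't\<close>, and a \<open>p \<times> t\<close> matrix
  has type \<open>real^'t^'p\<close>.
\<close>

definition ones :: "real^'k" where
  "ones = (\<chi> i. 1)"

definition J_mat :: "real^'k^'k" where
  "J_mat = (\<chi> i j. 1)"

definition B_mat :: "real^'k^'k" where
  "B_mat = mat 1 - (1 / real CARD('k)) *\<^sub>R J_mat"

definition positive_definite :: "real^'k^'k \<Rightarrow> bool" where
  "positive_definite M \<longleftrightarrow> (\<forall>x. x \<noteq> 0 \<longrightarrow> x \<bullet> (M *v x) > 0)"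

definition B_tilde :: "real^'p^'p \<Rightarrow> real^'p^'p" where
  "B_tilde \<Sigma> = matrix_inv \<Sigma> -
     (1 / (ones \<bullet> (matrix_inv \<Sigma> *v ones))) *\<^sub>R (matrix_inv \<Sigma> ** J_mat ** matrix_inv \<Sigma>)"

definition T_mat :: "('p \<Rightarrow> 't) \<Rightarrow> real^'t^'p" where
  "T_mat s = (\<chi> k i. if s k = i then 1 else 0)"

text \<open>\<open>Max {..<k}\<close> is the period immediately before \<open>k\<close>.\<close>

definition F_mat :: "('p \<Rightarrow> 't) \<Rightarrow> real^'t^'p::{finite,linorder}" where
  "F_mat s = (\<chi> k i. if {..<k} \<noteq> {} \<and> s (Max {..<k}) = i then 1 else 0)"

text \<open>The indices 1 and 2 of the block matrices are natural numbers; only these two values are used.\<close>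

definition G_seq :: "real \<Rightarrow> ('p \<Rightarrow> 't) \<Rightarrow> nat \<Rightarrow> real^'t^'p::{finite,linorder}" where
  "G_seq lam0 s i = (if i = 1 then F_mat s else T_mat s + lam0 *\<^sub>R F_mat s)"

definition A_hat ::
  "real^'p::{finite,linorder}^'p::{finite,linorder} \<Rightarrow> real \<Rightarrow> ('p \<Rightarrow> 't) \<Rightarrow>
     nat \<Rightarrow> nat \<Rightarrow> real^'t^'t" where
  "A_hat \<Sigma> lam0 s i j =
     B_mat ** transpose (G_seq lam0 s i) ** B_tilde \<Sigma> ** G_seq lam0 s j ** B_mat"

definition approx_design :: "(('p::finite \<Rightarrow> 't::finite) \<Rightarrow> real) \<Rightarrow> bool" where
  "approx_design P \<longleftrightarrow> (\<forall>s. 0 \<le> P s) \<and> (\<Sum>s\<in>UNIV. P s) = 1"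

definition A_hat_design ::
  "real^'p::{finite,linorder}^'p::{finite,linorder} \<Rightarrow> real \<Rightarrow> nat \<Rightarrow> (('p \<Rightarrow> 't::finite) \<Rightarrow> real) \<Rightarrow>
     nat \<Rightarrow> nat \<Rightarrow> real^'t^'t" where
  "A_hat_design \<Sigma> lam0 n P i j = real n *\<^sub>R (\<Sum>s\<in>UNIV. P s *\<^sub>R A_hat \<Sigma> lam0 s i j)"

definition G_design ::
  "real \<Rightarrow> (('p \<Rightarrow> 't::finite) \<Rightarrow> real) \<Rightarrow> nat \<Rightarrow> real^'t^'p::{finite,linorder}" where
  "G_design lam0 P i = (\<Sum>s\<in>UNIV. P s *\<^sub>R (G_seq lam0 s i ** B_mat))"

definition A_block ::
  "real^'p::{finite,linorder}^'p::{finite,linorder} \<Rightarrow> real \<Rightarrow> nat \<Rightarrow> (('p \<Rightarrow> 't::finite) \<Rightarrow> real) \<Rightarrow>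
     nat \<Rightarrow> nat \<Rightarrow> real^'t^'t" where
  "A_block \<Sigma> lam0 n P i j = A_hat_design \<Sigma> lam0 n P i j -
     real n *\<^sub>R (transpose (G_design lam0 P i) ** B_tilde \<Sigma> ** G_design lam0 P j)"

definition generalized_inverse :: "real^'k^'m \<Rightarrow> real^'m^'k \<Rightarrow> bool" where
  "generalized_inverse M G \<longleftrightarrow> M ** G ** M = M"

lemma generalized_inverse_exists: "\<exists>G. generalized_inverse (M :: real^'k^'m) G"
proof -
  obtain g where g: "linear g" "\<forall>v\<in>(*v) M ` UNIV. M *v g v = v"
    using linear_exists_right_inverse_on[OF matrix_vector_mul_linear[of M] subspace_UNIV] by auto
  have "(M ** matrix g ** M) *v x = M *v x" for x
    using g by (simp add: matrix_vector_mul_assoc[symmetric] matrix_works linear_matrix_vector_mul_eq)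
  then have "M ** matrix g ** M = M"
    by (simp add: matrix_eq)
  then show ?thesis
    unfolding generalized_inverse_def by blast
qed

text \<open>\<open>ginv\<close> selects a generalized inverse of each square matrix.\<close>

definition A_info ::
  "(real^'t^'t \<Rightarrow> real^'t^'t) \<Rightarrow> real^'p::{finite,linorder}^'p::{finite,linorder} \<Rightarrow> real \<Rightarrow> nat \<Rightarrow>
     (('p \<Rightarrow> 't::finite) \<Rightarrow> real) \<Rightarrow> real^'t^'t" where
  "A_info ginv \<Sigma> lam0 n P = A_block \<Sigma> lam0 n P 1 1 -
     A_block \<Sigma> lam0 n P 1 2 ** ginv (A_block \<Sigma> lam0 n P 2 2) ** A_block \<Sigma> lam0 n P 2 1"

definition prior :: "(real^'t) measure \<Rightarrow> bool" where
  "prior g \<longleftrightarrow> prob_space g \<and> sets g = sets borel \<and>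
     (AE \<tau> in g. ones \<bullet> \<tau> = 0 \<and> \<tau> \<noteq> 0)"

definition exchangeable :: "(real^'t) measure \<Rightarrow> bool" where
  "exchangeable g \<longleftrightarrow> (\<forall>\<pi> :: 't \<Rightarrow> 't. bij \<pi> \<longrightarrow> distr g borel (\<lambda>\<tau>. \<chi> i. \<tau> $ \<pi> i) = g)"

text \<open>
  The expectation may be infinite, hence the extended nonnegative integral. For positive definite
  \<open>\<Sigma>\<close> and a \<open>ginv\<close> giving generalized inverses, \<open>A_info\<close> is nonnegative definite for every design, so \<open>ennreal\<close> truncates nothing.
\<close>

definition phi ::
  "(real^'t^'t \<Rightarrow> real^'t^'t) \<Rightarrow> real^'p::{finite,linorder}^'p::{finite,linorder} \<Rightarrow> nat \<Rightarrow>
     (real^'t) measure \<Rightarrow> real \<Rightarrow>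
     (('p \<Rightarrow> 't::finite) \<Rightarrow> real) \<Rightarrow> ennreal" where
  "phi ginv \<Sigma> n g lam0 P = (\<integral>\<^sup>+ \<tau>. ennreal (\<tau> \<bullet> (A_info ginv \<Sigma> lam0 n P *v \<tau>)) \<partial>g)"

definition h_seq ::
  "real^'p::{finite,linorder}^'p::{finite,linorder} \<Rightarrow> real \<Rightarrow> ('p \<Rightarrow> 't::finite) \<Rightarrow>
     nat \<Rightarrow> nat \<Rightarrow> real" where
  "h_seq \<Sigma> lam0 s i j = trace (A_hat \<Sigma> lam0 s i j)"

definition r_seq ::
  "real^'p::{finite,linorder}^'p::{finite,linorder} \<Rightarrow> real \<Rightarrow> ('p \<Rightarrow> 't::finite) \<Rightarrow> real \<Rightarrow> real" where
  "r_seq \<Sigma> lam0 s x = h_seq \<Sigma> lam0 s 1 1 + 2 * h_seq \<Sigma> lam0 s 1 2 * x + h_seq \<Sigma> lam0 s 2 2 * x\<^sup>2"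

text \<open>The otherwise undetermined type \<open>'t\<close> of treatments is passed as a type argument.\<close>

definition r_max ::
  "'t::finite itself \<Rightarrow> real^'p::{finite,linorder}^'p::{finite,linorder} \<Rightarrow> real \<Rightarrow> real \<Rightarrow> real" where
  "r_max _ \<Sigma> lam0 x = (MAX s \<in> (UNIV :: ('p \<Rightarrow> 't) set). r_seq \<Sigma> lam0 s x)"

definition R_set ::
  "real^'p::{finite,linorder}^'p::{finite,linorder} \<Rightarrow> real \<Rightarrow> real \<Rightarrow> real \<Rightarrow> ('p \<Rightarrow> 't::finite) set" where
  "R_set \<Sigma> lam0 x\<^sub>0 y\<^sub>0 = {s. r_seq \<Sigma> lam0 s x\<^sub>0 = y\<^sub>0}"

end

theory Submission
  imports Defs
begin

text \<open>
  Write \<open>M\<^sub>s\<close> for \<open>A_hat\<^sub>1\<^sub>1 + x\<^sub>0 (A_hat\<^sub>1\<^sub>2 + A_hat\<^sub>2\<^sub>1) + x\<^sub>0\<^sup>2 A_hat\<^sub>2\<^sub>2\<close> at the sequence \<open>s\<close>, a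
  nonnegative definite matrix with trace \<open>r\<^sub>s(x\<^sub>0) \<le> y\<^sub>0\<close>. The Schur complement minimises the block
  quadratic form over its second argument, so evaluating that form at \<open>(\<tau>, x\<^sub>0 \<tau>)\<close>, and dropping the
  nonnegative term that comes from the mean, bounds the information of any design \<open>Q\<close> by
  \<open>n \<Sum>\<^sub>s Q\<^sub>s \<tau>' M\<^sub>s \<tau>\<close>. Averaging over coordinate permutations replaces \<open>\<tau> \<tau>'\<close> by
  \<open>\<bar>\<tau>\<bar>\<^sup>2 B / (t - 1)\<close>, so under an exchangeable prior this bound has expectation at most that of
  \<open>n y\<^sub>0 \<bar>\<tau>\<bar>\<^sup>2 / (t - 1)\<close>. The conditions on \<open>P\<close> say that \<open>A\<^sub>2\<^sub>1 = - x\<^sub>0 A\<^sub>2\<^sub>2\<close> and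
  \<open>A\<^sub>1\<^sub>1 + x\<^sub>0 A\<^sub>1\<^sub>2 = (n y\<^sub>0 / (t - 1)) B\<close>, so its information matrix is exactly \<open>(n y\<^sub>0 / (t - 1)) B\<close>.
  Averaging pointwise before integrating avoids any assumption of finite second moments.
\<close>

section \<open>Matrix-vector identities\<close>

lemma inner_transpose_mult:
  fixes A :: "real^'m^'n"
  shows "x \<bullet> (transpose A *v y) = (A *v x) \<bullet> y"
  by (metis dot_lmul_matrix inner_commute transpose_matrix_vector)

lemma symmetric_inner:
  fixes A :: "real^'n^'n"
  assumes "transpose A = A"
  shows "x \<bullet> (A *v y) = (A *v x) \<bullet> y"
  by (metis assms inner_transpose_mult)

lemma sum_matrix_vector_mult:
  fixes f :: "'a \<Rightarrow> real^'m^'n"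
  shows "(\<Sum>s\<in>S. f s) *v x = (\<Sum>s\<in>S. f s *v x)"
  by (induction S rule: infinite_finite_induct) (simp_all add: matrix_vector_mult_add_rdistrib)

lemma matrix_vector_mult_sum:
  fixes A :: "real^'m^'n"
  shows "A *v (\<Sum>s\<in>S. f s) = (\<Sum>s\<in>S. A *v f s)"
  by (induction S rule: infinite_finite_induct) (simp_all add: matrix_vector_right_distrib)

lemma quadratic_form_sub:
  fixes A :: "real^'n^'n"
  assumes "transpose A = A"
  shows "(x - y) \<bullet> (A *v (x - y)) = x \<bullet> (A *v x) - 2 * (x \<bullet> (A *v y)) + y \<bullet> (A *v y)"
  using symmetric_inner[OF assms, of y x]
  by (simp add: matrix_vector_mult_diff_distrib inner_diff inner_commute)

lemma matrix_add_mult_distrib: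
  fixes A B :: "real^'m^'n" and C :: "real^'k^'m"
  shows "(A + B) ** C = A ** C + B ** C"
  by (simp add: matrix_matrix_mult_def vec_eq_iff distrib_right sum.distrib)

lemma sum_matrix_mult:
  fixes f :: "'a \<Rightarrow> real^'m^'n" and C :: "real^'k^'m"
  shows "(\<Sum>s\<in>S. f s) ** C = (\<Sum>s\<in>S. f s ** C)"
  by (induction S rule: infinite_finite_induct) (simp_all add: matrix_add_mult_distrib)

section \<open>The centering matrix, transposes and traces\<close>

lemma transpose_J_mat: "transpose J_mat = J_mat"
  by (simp add: J_mat_def transpose_def)

lemma J_mat_mult_vec: "J_mat *v x = (ones \<bullet> x) *\<^sub>R ones"
  by (simp add: J_mat_def ones_def matrix_vector_mult_def vec_eq_iff inner_vec_def)

lemma B_mat_mult_vec: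
  "(B_mat :: real^'k::finite^'k) *v x = x - ((ones \<bullet> x) / real CARD('k)) *\<^sub>R ones"
  by (simp add: B_mat_def matrix_vector_mult_diff_rdistrib J_mat_mult_vec
      flip: scaleR_matrix_vector_assoc)

lemma transpose_B_mat: "transpose B_mat = (B_mat :: real^'k::finite^'k)"
  by (simp add: B_mat_def J_mat_def transpose_def mat_def vec_eq_iff eq_commute)

lemma B_mat_idem: "B_mat ** B_mat = (B_mat :: real^'k::finite^'k)"
proof -
  have "(ones :: real^'k) \<bullet> ones = real CARD('k)"
    by (simp add: ones_def inner_vec_def)
  then show ?thesis
    by (simp add: matrix_eq B_mat_mult_vec inner_diff_right flip: matrix_vector_mul_assoc)
qed

lemma trace_scaleR: "trace (c *\<^sub>R A) = c * trace (A :: real^'n^'n)"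
  by (simp add: trace_def sum_distrib_left)

lemma trace_transpose: "trace (transpose A) = trace A"
  by (simp add: trace_def transpose_def)

section \<open>Positive definiteness of the inverse covariance and nonnegativity of
  \<open>B_tilde\<close>\<close>

lemma positive_definite_nonneg:
  assumes "positive_definite S"
  shows "0 \<le> x \<bullet> (S *v x)"
  using assms unfolding positive_definite_def by (cases "x = 0") (auto intro: less_imp_le)

lemma positive_definite_invertible:
  fixes S :: "real^'k^'k"
  assumes "positive_definite S"
  shows "invertible S"
  using assms unfolding positive_definite_def
  by (metis inner_zero_right invertible_left_inverse less_irrefl matrix_left_invertible_ker)

lemma matrix_inv_symmetric_pos_def:
  fixes S :: "real^'k::finite^'k"
  assumes sym: "transpose S = S" and pd: "positive_definite S"
  shows "transpose (matrix_inv S) = matrix_inv S" and "positive_definite (matrix_inv S)"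
proof -
  note inv = positive_definite_invertible[OF pd]
  have right: "S ** matrix_inv S = mat 1" and left: "matrix_inv S ** S = mat 1"
    using inv unfolding invertible_def matrix_inv_def by (metis (mono_tags, lifting) someI_ex)+
  have "transpose (matrix_inv S) ** S = mat 1"
    using right by (metis matrix_transpose_mul sym transpose_mat)
  then show "transpose (matrix_inv S) = matrix_inv S"
    using right by (metis matrix_mul_assoc matrix_mul_lid matrix_mul_rid)
  have S_inv: "S *v (matrix_inv S *v x) = x" for x
    by (simp add: matrix_vector_mul_assoc right)
  \<comment> \<open>With \<open>y = matrix_inv S *v x\<close>, so that \<open>x = S *v y\<close>,
    the form of the inverse at \<open>x\<close> equals the form of \<open>S\<close> at
    \<open>y\<close>.\<close>
  show "positive_definite (matrix_inv S)"
    unfolding positive_definite_def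
  proof (intro allI impI)
    fix x :: "real^'k" assume "x \<noteq> 0"
    then have "matrix_inv S *v x \<noteq> 0"
      using S_inv[of x] by auto
    then have "0 < (matrix_inv S *v x) \<bullet> (S *v (matrix_inv S *v x))"
      using pd unfolding positive_definite_def by blast
    then show "0 < x \<bullet> (matrix_inv S *v x)"
      by (simp add: S_inv inner_commute)
  qed
qed

lemma B_tilde_mult_vec:
  "B_tilde S *v x = matrix_inv S *v x -
    ((ones \<bullet> (matrix_inv S *v x)) / (ones \<bullet> (matrix_inv S *v ones))) *\<^sub>R (matrix_inv S *v ones)"
  by (simp add: B_tilde_def matrix_vector_mult_diff_rdistrib J_mat_mult_vec
      matrix_vector_mult_scaleR flip: matrix_vector_mul_assoc scaleR_matrix_vector_assoc)

lemma transpose_B_tilde: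
  assumes "transpose S = S" and "positive_definite S"
  shows "transpose (B_tilde S) = B_tilde S"
proof -
  note t = matrix_inv_symmetric_pos_def(1)[OF assms]
  have "transpose (matrix_inv S ** J_mat ** matrix_inv S) = matrix_inv S ** J_mat ** matrix_inv S"
    by (simp add: matrix_transpose_mul t transpose_J_mat matrix_mul_assoc)
  then show ?thesis
    using t unfolding B_tilde_def by (simp add: transpose_def vec_eq_iff)
qed

text \<open>In the inner product given by the inverse of \<open>S\<close>,
  \<open>x \<bullet> (B_tilde S *v x)\<close> is the squared length of what remains of
  \<open>x\<close> after projecting out \<open>ones\<close>.\<close>

lemma B_tilde_nonneg:
  fixes S :: "real^'k::finite^'k"
  assumes "transpose S = S" and "positive_definite S"
  shows "0 \<le> x \<bullet> (B_tilde S *v x)"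
proof -
  let ?V = "matrix_inv S"
  note V = matrix_inv_symmetric_pos_def[OF assms]
  have "(ones :: real^'k) \<noteq> 0"
    by (simp add: ones_def vec_eq_iff)
  then have pos: "0 < (ones :: real^'k) \<bullet> (?V *v ones)"
    using V(2) unfolding positive_definite_def by blast
  \<comment> \<open>The coefficient of that projection, i.e. the generalized least squares fit of
    \<open>x\<close> by a multiple of \<open>ones\<close>.\<close>
  define c where "c = (ones \<bullet> (?V *v x)) / (ones \<bullet> (?V *v ones))"
  have sym: "x \<bullet> (?V *v ones) = ones \<bullet> (?V *v x)"
    by (metis V(1) inner_commute symmetric_inner)
  have "0 \<le> (x - c *\<^sub>R ones) \<bullet> (?V *v (x - c *\<^sub>R ones))"
    using V(2) by (rule positive_definite_nonneg)
  also have "\<dots> = x \<bullet> (?V *v x) - 2 * c * (ones \<bullet> (?V *v x)) + c * c * (ones \<bullet> (?V *v ones))"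
    by (simp add: quadratic_form_sub[OF V(1)] matrix_vector_mult_scaleR sym)
  also have "\<dots> = x \<bullet> (B_tilde S *v x)"
    using pos by (simp add: B_tilde_mult_vec inner_diff_right sym c_def)
  finally show ?thesis .
qed

section \<open>Schur complements with an arbitrary generalized inverse\<close>

text \<open>The range of a symmetric matrix is the orthogonal complement of its kernel. The
  component \<open>z\<close> of \<open>b\<close> orthogonal to the range lies in the kernel, because
  \<open>M *v z\<close> has inner product \<open>z \<bullet> (M *v (M *v z)) = 0\<close> with
  itself; the hypothesis then forces \<open>z = 0\<close>.\<close>

lemma in_range_symmetric:
  fixes M :: "real^'n^'n"
  assumes sym: "transpose M = M" and ker: "\<And>z. M *v z = 0 \<Longrightarrow> z \<bullet> b = 0"
  shows "\<exists>u. M *v u = b"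
proof -
  obtain y z where y: "y \<in> span (range ((*v) M))"
    and z: "\<And>w. w \<in> span (range ((*v) M)) \<Longrightarrow> orthogonal z w" and b: "b = y + z"
    using orthogonal_subspace_decomp_exists[of "range ((*v) M)" b] by blast
  have "(M *v z) \<bullet> (M *v z) = 0"
    using z[of "M *v (M *v z)"] by (simp add: span_base orthogonal_def symmetric_inner[OF sym])
  then have "M *v z = 0"
    by simp
  then have "z \<bullet> b = 0"
    by (rule ker)
  moreover have "z \<bullet> y = 0"
    using z[OF y] by (simp add: orthogonal_def)
  ultimately have "z = 0"
    using b by (simp add: inner_add_right)
  moreover have "span (range ((*v) M)) = range ((*v) M)"
    by (simp add: linear_subspace_image matrix_vector_mul_linear span_eq_iff)
  then have "y \<in> range ((*v) M)"
    using y by blast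
  ultimately show ?thesis
    using b by auto
qed

text \<open>Nonnegativity of the block form puts \<open>C *v u\<close> in the range of
  \<open>D\<close>, say \<open>C *v u = D *v w\<close>. The subtracted term is then
  \<open>w \<bullet> (D *v w)\<close> for every choice of \<open>G\<close>, and completing the
  square shows that the two sides differ by the form of \<open>D\<close> at
  \<open>w + x *\<^sub>R u\<close>.\<close>

lemma schur_complement_le:
  fixes A B C D G :: "real^'n^'n"
  assumes psd: "\<And>u v. 0 \<le> u \<bullet> (A *v u) + 2 * (v \<bullet> (C *v u)) + v \<bullet> (D *v v)"
    and adj: "\<And>u v. u \<bullet> (B *v v) = (C *v u) \<bullet> v"
    and sym: "transpose D = D"
    and G: "generalized_inverse D G"
  shows "u \<bullet> ((A - B ** G ** C) *v u) \<le> u \<bullet> (A *v u) + 2 * x * (u \<bullet> (C *v u)) + x\<^sup>2 * (u \<bullet> (D *v u))"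
proof -
  have "z \<bullet> (C *v u) = 0" if z: "D *v z = 0" for z
  proof (rule ccontr)
    define a k where "a = u \<bullet> (A *v u)" and "k = z \<bullet> (C *v u)"
    assume "z \<bullet> (C *v u) \<noteq> 0"
    then have "k \<noteq> 0" by (simp add: k_def)
    have "0 \<le> a + 2 * (c * k)" for c
      using psd[of u "c *\<^sub>R z"] by (simp add: a_def k_def z matrix_vector_mult_scaleR)
    \<comment> \<open>This value of \<open>c\<close> makes \<open>a + 2 * (c * k)\<close> equal to
      -1: a form that is affine in \<open>c\<close> and bounded below has zero slope.\<close>
    from this[of "- (a + 1) / (2 * k)"] \<open>k \<noteq> 0\<close>
    have "a + 1 \<le> a" by (simp add: field_simps)
    then show False by simp
  qed
  then obtain w where w: "D *v w = C *v u"
    using in_range_symmetric[OF sym] by blast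
  have "D *v (G *v (D *v w)) = D *v w"
    using G unfolding generalized_inverse_def by (metis matrix_vector_mul_assoc)
  then have "u \<bullet> ((B ** G ** C) *v u) = w \<bullet> (D *v w)"
    by (simp add: adj w symmetric_inner[OF sym, of w] flip: matrix_vector_mul_assoc)
      (metis w symmetric_inner[OF sym])
  \<comment> \<open>Setting the first argument of the block form to zero leaves the form of
    \<open>D\<close> alone.\<close>
  moreover have "0 \<le> (w + x *\<^sub>R u) \<bullet> (D *v (w + x *\<^sub>R u))"
    using psd[of 0] by simp
  then have "0 \<le> w \<bullet> (D *v w) + 2 * x * (u \<bullet> (C *v u)) + x\<^sup>2 * (u \<bullet> (D *v u))"
    using symmetric_inner[OF sym, of w u] w
    by (simp add: matrix_vector_right_distrib matrix_vector_mult_scaleR inner_add power2_eq_square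
        algebra_simps inner_commute)
  ultimately show ?thesis
    by (simp add: matrix_vector_mult_diff_rdistrib inner_diff_right)
qed

section \<open>Averaging quadratic forms over coordinate permutations\<close>

text \<open>The summed products form a matrix invariant under simultaneous permutation of rows and
  columns, so its diagonal is constant and so are its off-diagonal entries. Its trace and its
  vanishing row sums determine these two values.\<close>

lemma sum_permutations_products:
  fixes x :: "real^'t::finite" and i j :: 't
  assumes t: "CARD('t) \<ge> 2" and x: "ones \<bullet> x = 0"
  shows "(\<Sum>\<pi>\<in>{\<pi>. bij \<pi>}. x $ \<pi> i * x $ \<pi> j) =
    real (card {\<pi> :: 't \<Rightarrow> 't. bij \<pi>}) * (x \<bullet> x) / (real CARD('t) - 1) * B_mat $ i $ j"
proof -
  let ?S = "{\<pi> :: 't \<Rightarrow> 't. bij \<pi>}"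
  define m where "m i j = (\<Sum>\<pi>\<in>?S. x $ \<pi> i * x $ \<pi> j)" for i j
  define N where "N = real (card ?S)"
  have inv: "m (\<sigma> i) (\<sigma> j) = m i j" if "bij \<sigma>" for \<sigma> i j
    unfolding m_def
    by (rule sum.reindex_bij_witness[of _ "\<lambda>\<pi>. \<pi> \<circ> inv \<sigma>" "\<lambda>\<pi>. \<pi> \<circ> \<sigma>"])
      (use that in \<open>auto simp: bij_comp bij_imp_bij_inv comp_assoc bij_is_inj surj_iff[THEN iffD1, OF bij_is_surj]\<close>)
  have diag: "m i i = m j j" for i j
    using inv[of "Transposition.transpose i j" j j] by simp
  have total: "(\<Sum>i\<in>UNIV. x $ \<pi> i * x $ \<pi> i) = x \<bullet> x" if "bij \<pi>" for \<pi>
    using sum.reindex_bij_betw[OF that, of "\<lambda>i. x $ i * x $ i"] by (simp add: inner_vec_def)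
  have zero: "(\<Sum>j\<in>UNIV. x $ \<pi> j) = 0" if "bij \<pi>" for \<pi>
    using sum.reindex_bij_betw[OF that, of "\<lambda>i. x $ i"] x by (simp add: inner_vec_def ones_def)
  have "(\<Sum>i\<in>UNIV. m i i) = N * (x \<bullet> x)"
    unfolding m_def by (subst sum.swap) (simp add: total N_def)
  moreover have "(\<Sum>k\<in>UNIV. m k k) = real CARD('t) * m i i" for i :: 't
  proof -
    have "(\<Sum>k\<in>UNIV. m k k) = (\<Sum>k\<in>(UNIV :: 't set). m i i)"
      by (rule sum.cong[OF refl diag])
    then show ?thesis
      by simp
  qed
  ultimately have mii: "real CARD('t) * m i i = N * (x \<bullet> x)" for i
    by metis
  have row: "(\<Sum>j\<in>UNIV. m i j) = 0" for i
    unfolding m_def by (subst sum.swap) (simp add: zero flip: sum_distrib_left)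
  have off: "m i j = m i k" if "j \<noteq> i" "k \<noteq> i" for i j k :: 't
    using inv[of "Transposition.transpose j k" i k] that by simp
  \<comment> \<open>A row consists of one diagonal entry and \<open>CARD('t) - 1\<close> equal
    off-diagonal entries, and it sums to zero.\<close>
  have mij: "(real CARD('t) - 1) * m i j = - m i i" if "j \<noteq> i" for i j :: 't
  proof -
    have "(\<Sum>k\<in>UNIV. m i k) = m i i + (\<Sum>k\<in>UNIV - {i}. m i k)"
      by (simp add: sum.remove)
    also have "(\<Sum>k\<in>UNIV - {i}. m i k) = (\<Sum>k\<in>UNIV - {i}. m i j)"
      using off[OF that] by (intro sum.cong) auto
    also have "\<dots> = (real CARD('t) - 1) * m i j"
      using t by (simp add: of_nat_diff)
    finally show ?thesis
      using row[of i] by simp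
  qed
  have "m i j = N * (x \<bullet> x) / (real CARD('t) - 1) * B_mat $ i $ j"
  proof (cases "i = j")
    case True
    then have B: "B_mat $ i $ j = 1 - 1 / real CARD('t)"
      by (simp add: B_mat_def J_mat_def mat_def)
    have m: "m i j = m i i"
      using True by simp
    show ?thesis
      \<comment> \<open>Reading \<open>mii\<close> backwards replaces
        \<open>N * (x \<bullet> x)\<close> by a multiple of \<open>m i i\<close>, which leaves an
        identity of fractions.\<close>
      unfolding m B mii[of i, symmetric] using t by (simp add: field_simps)
  next
    case False
    then have B: "B_mat $ i $ j = - (1 / real CARD('t))"
      by (simp add: B_mat_def J_mat_def mat_def)
    show ?thesis
      using mij[of j i] False t unfolding B mii[of i, symmetric] by (simp add: field_simps)
  qed
  then show ?thesis
    by (simp add: m_def N_def)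
qed

lemma sum_permutations_quadratic_form:
  fixes x :: "real^'t::finite" and M :: "real^'t^'t"
  assumes t: "CARD('t) \<ge> 2" and x: "ones \<bullet> x = 0"
  shows "(\<Sum>\<pi>\<in>{\<pi>. bij \<pi>}. (\<chi> i. x $ \<pi> i) \<bullet> (M *v (\<chi> i. x $ \<pi> i))) =
    real (card {\<pi> :: 't \<Rightarrow> 't. bij \<pi>}) * (trace (M ** B_mat) / (real CARD('t) - 1) * (x \<bullet> x))"
proof -
  have "(\<Sum>\<pi>\<in>{\<pi>. bij \<pi>}. (\<chi> i. x $ \<pi> i) \<bullet> (M *v (\<chi> i. x $ \<pi> i))) =
     (\<Sum>\<pi>\<in>{\<pi>. bij \<pi>}. \<Sum>i\<in>UNIV. \<Sum>j\<in>UNIV. M $ i $ j * (x $ \<pi> j * x $ \<pi> i))"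
    by (simp add: inner_vec_def matrix_vector_mult_def sum_distrib_left ac_simps)
  also have "\<dots> = (\<Sum>i\<in>UNIV. \<Sum>j\<in>UNIV. M $ i $ j * (\<Sum>\<pi>\<in>{\<pi>. bij \<pi>}. x $ \<pi> j * x $ \<pi> i))"
    by (subst sum.swap, intro sum.cong refl, subst sum.swap) (simp add: sum_distrib_left)
  also have "\<dots> = real (card {\<pi> :: 't \<Rightarrow> 't. bij \<pi>}) * (x \<bullet> x) / (real CARD('t) - 1) *
      (\<Sum>i\<in>UNIV. \<Sum>j\<in>UNIV. M $ i $ j * B_mat $ j $ i)"
    unfolding sum_permutations_products[OF t x] by (simp add: sum_distrib_left sum_divide_distrib ac_simps)
  finally show ?thesis
    by (simp add: trace_def matrix_matrix_mult_def)
qed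

text \<open>Exchangeability gives all permuted forms the same integral, so the integral times the
  number of permutations is the integral of the permutation sum, which is known pointwise.\<close>

lemma nn_integral_exchangeable_quadratic_form:
  fixes M :: "real^'t::finite^'t"
  assumes t: "CARD('t) \<ge> 2" and "prior g" and ex: "exchangeable g"
    and psd: "\<And>x. 0 \<le> x \<bullet> (M *v x)"
  shows "(\<integral>\<^sup>+ x. ennreal (x \<bullet> (M *v x)) \<partial>g) =
    (\<integral>\<^sup>+ x. ennreal (trace (M ** B_mat) / (real CARD('t) - 1) * (x \<bullet> x)) \<partial>g)"
proof -
  let ?S = "{\<pi> :: 't \<Rightarrow> 't. bij \<pi>}"
  let ?p = "\<lambda>\<pi> (x :: real^'t). \<chi> i. x $ \<pi> i"
  let ?q = "\<lambda>x. x \<bullet> (M *v x)"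
  let ?c = "trace (M ** B_mat) / (real CARD('t) - 1)"
  have [measurable_cong]: "sets g = sets borel" and ae: "AE x in g. ones \<bullet> x = 0"
    using \<open>prior g\<close> by (auto simp: prior_def)
  have [measurable]: "?q \<in> borel_measurable borel" for M :: "real^'t^'t"
    by (intro borel_measurable_continuous_onI continuous_intros linear_continuous_on)
       (simp add: linear_linear)
  have [measurable]: "?p \<pi> \<in> borel_measurable borel" for \<pi>
    by (intro borel_measurable_continuous_onI continuous_intros)
  have perm: "(\<integral>\<^sup>+ x. ennreal (?q (?p \<pi> x)) \<partial>g) = (\<integral>\<^sup>+ x. ennreal (?q x) \<partial>g)" if "bij \<pi>" for \<pi>
  proof -
    have "distr g borel (?p \<pi>) = g"
      using ex that unfolding exchangeable_def by blast
    then have "(\<integral>\<^sup>+ x. ennreal (?q x) \<partial>g) = (\<integral>\<^sup>+ x. ennreal (?q x) \<partial>distr g borel (?p \<pi>))"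
      by simp
    then show ?thesis
      by (simp add: nn_integral_distr)
  qed
  have "of_nat (card ?S) * (\<integral>\<^sup>+ x. ennreal (?q x) \<partial>g) = (\<Sum>\<pi>\<in>?S. \<integral>\<^sup>+ x. ennreal (?q (?p \<pi> x)) \<partial>g)"
    by (simp add: perm)
  also have "\<dots> = (\<integral>\<^sup>+ x. (\<Sum>\<pi>\<in>?S. ennreal (?q (?p \<pi> x))) \<partial>g)"
    by (rule nn_integral_sum[symmetric]) measurable
  \<comment> \<open>The zero-sum condition holds only almost everywhere. Nonnegativity of the form
    lets \<open>ennreal\<close> commute with the finite sum.\<close>
  also have "\<dots> = (\<integral>\<^sup>+ x. of_nat (card ?S) * ennreal (?c * (x \<bullet> x)) \<partial>g)"
    using ae
    by (intro nn_integral_cong_AE)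
      (auto simp: sum_permutations_quadratic_form[OF t] sum_ennreal psd ennreal_of_nat_eq_real_of_nat
        simp del: times_divide_eq_left elim!: eventually_mono simp flip: ennreal_mult')
  also have "\<dots> = of_nat (card ?S) * (\<integral>\<^sup>+ x. ennreal (?c * (x \<bullet> x)) \<partial>g)"
    by (rule nn_integral_cmult) measurable
  finally have "of_nat (card ?S) * (\<integral>\<^sup>+ x. ennreal (?q x) \<partial>g) =
      of_nat (card ?S) * (\<integral>\<^sup>+ x. ennreal (?c * (x \<bullet> x)) \<partial>g)" .
  \<comment> \<open>Cancelling the number of permutations in \<open>ennreal\<close> requires it to
    be nonzero and finite.\<close>
  moreover have "?S \<noteq> {}"
    using bij_id by blast
  then have "card ?S \<noteq> 0"
    by (simp add: card_eq_0_iff)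
  ultimately show ?thesis
    unfolding ennreal_mult_cancel_left by (simp del: card_eq_0_iff card_0_eq)
qed


section \<open>Information blocks of a design as covariances over sequences\<close>

text \<open>Grouping each outer \<open>B_mat\<close> with its neighbouring \<open>G_seq\<close>
  presents \<open>A_hat\<close> as a Gram matrix with respect to \<open>B_tilde\<close>.\<close>

lemma A_hat_mult_vec:
  "A_hat \<Sigma> lam0 s i j *v v = transpose (G_seq lam0 s i ** B_mat) *v
    (B_tilde \<Sigma> *v ((G_seq lam0 s j ** B_mat) *v v))"
  by (simp add: A_hat_def matrix_transpose_mul transpose_B_mat matrix_vector_mul_assoc matrix_mul_assoc
      del: transpose_matrix_vector)

lemma inner_A_hat:
  "u \<bullet> (A_hat \<Sigma> lam0 s i j *v v) = ((G_seq lam0 s i ** B_mat) *v u) \<bullet>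
    (B_tilde \<Sigma> *v ((G_seq lam0 s j ** B_mat) *v v))"
  by (simp only: A_hat_mult_vec inner_transpose_mult)

lemma transpose_A_hat:
  assumes "transpose \<Sigma> = \<Sigma>" and "positive_definite \<Sigma>"
  shows "transpose (A_hat \<Sigma> lam0 s i j) = A_hat \<Sigma> lam0 s j i"
  by (simp add: A_hat_def matrix_transpose_mul transpose_B_mat transpose_B_tilde[OF assms] matrix_mul_assoc)

lemma A_hat_mult_B_mat: "A_hat \<Sigma> lam0 s i j ** B_mat = A_hat \<Sigma> lam0 s i j"
  by (simp add: A_hat_def B_mat_idem flip: matrix_mul_assoc)

lemma G_design_mult_vec:
  "G_design lam0 P i *v v = (\<Sum>s\<in>UNIV. P s *\<^sub>R ((G_seq lam0 s i ** B_mat) *v v))"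
  by (simp add: G_design_def sum_matrix_vector_mult flip: scaleR_matrix_vector_assoc)

lemma A_block_mult_vec:
  "A_block \<Sigma> lam0 n P i j *v v = real n *\<^sub>R ((\<Sum>s\<in>UNIV. P s *\<^sub>R (A_hat \<Sigma> lam0 s i j *v v)) -
    transpose (G_design lam0 P i) *v (B_tilde \<Sigma> *v (G_design lam0 P j *v v)))"
  by (simp add: A_block_def A_hat_design_def matrix_vector_mult_diff_rdistrib sum_matrix_vector_mult
      scaleR_right_diff_distrib matrix_vector_mul_assoc matrix_mul_assoc
      del: transpose_matrix_vector flip: scaleR_matrix_vector_assoc)

lemma inner_A_block:
  "u \<bullet> (A_block \<Sigma> lam0 n P i j *v v) = real n * ((\<Sum>s\<in>UNIV. P s * (u \<bullet> (A_hat \<Sigma> lam0 s i j *v v))) -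
    (G_design lam0 P i *v u) \<bullet> (B_tilde \<Sigma> *v (G_design lam0 P j *v v)))"
  by (simp add: A_block_mult_vec inner_diff_right inner_sum_right inner_transpose_mult
      del: transpose_matrix_vector)

lemma transpose_A_block:
  assumes "transpose \<Sigma> = \<Sigma>" and "positive_definite \<Sigma>"
  shows "transpose (A_block \<Sigma> lam0 n P i j) = A_block \<Sigma> lam0 n P j i"
proof -
  let ?C = "B_tilde \<Sigma>"
  note C = symmetric_inner[OF transpose_B_tilde[OF assms]]
  have "u \<bullet> (A_block \<Sigma> lam0 n P i j *v v) = v \<bullet> (A_block \<Sigma> lam0 n P j i *v u)" for u v
  proof -
    have "u \<bullet> (A_hat \<Sigma> lam0 s i j *v v) = v \<bullet> (A_hat \<Sigma> lam0 s j i *v u)" for s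
      by (metis inner_commute inner_transpose_mult transpose_A_hat[OF assms])
    moreover have "(G_design lam0 P i *v u) \<bullet> (?C *v (G_design lam0 P j *v v)) =
        (G_design lam0 P j *v v) \<bullet> (?C *v (G_design lam0 P i *v u))"
      by (metis C inner_commute)
    ultimately show ?thesis
      by (simp only: inner_A_block)
  qed
  then have "u \<bullet> (transpose (A_block \<Sigma> lam0 n P i j) *v v) = u \<bullet> (A_block \<Sigma> lam0 n P j i *v v)" for u v
    unfolding inner_transpose_mult by (metis inner_commute)
  then show ?thesis
    by (metis matrix_eq vector_eq_ldot)
qed

text \<open>A variance is nonnegative: the right side minus the left is the weighted mean of the
  form at the deviations \<open>w s - m\<close>.\<close>

lemma form_mean_le:
  fixes C :: "real^'p^'p"
  assumes sym: "transpose C = C" and psd: "\<And>v. 0 \<le> v \<bullet> (C *v v)"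
    and P: "\<And>s. s \<in> S \<Longrightarrow> 0 \<le> P s" "sum P S = 1"
  shows "(\<Sum>s\<in>S. P s *\<^sub>R w s) \<bullet> (C *v (\<Sum>s\<in>S. P s *\<^sub>R w s)) \<le> (\<Sum>s\<in>S. P s * (w s \<bullet> (C *v w s)))"
proof -
  define m where "m = (\<Sum>s\<in>S. P s *\<^sub>R w s)"
  have cross: "(\<Sum>s\<in>S. P s * (w s \<bullet> (C *v m))) = m \<bullet> (C *v m)"
    by (simp add: m_def inner_sum_left)
  have "0 \<le> (\<Sum>s\<in>S. P s * ((w s - m) \<bullet> (C *v (w s - m))))"
    using P psd by (intro sum_nonneg mult_nonneg_nonneg) auto
  also have "\<dots> = (\<Sum>s\<in>S. P s * (w s \<bullet> (C *v w s))) - 2 * (\<Sum>s\<in>S. P s * (w s \<bullet> (C *v m))) + sum P S * (m \<bullet> (C *v m))"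
    by (simp add: quadratic_form_sub[OF sym] sum.distrib sum_subtractf sum_distrib_left
        sum_distrib_right distrib_left right_diff_distrib ac_simps)
  finally show ?thesis
    using cross P(2) by (simp add: m_def)
qed

text \<open>The block form at \<open>(u, v)\<close> is \<open>n\<close> times a variance: the
  \<open>P\<close>-mean of the \<open>B_tilde\<close> form of \<open>w\<close>, minus that form at
  the \<open>P\<close>-mean of \<open>w\<close>. The doubled term stands for both off-diagonal
  blocks, which are transposes of each other.\<close>

lemma A_block_quadratic_form:
  assumes \<Sigma>: "transpose \<Sigma> = \<Sigma>" "positive_definite \<Sigma>"
  defines "w \<equiv> \<lambda>lam0 u v s. (G_seq lam0 s 1 ** B_mat) *v u + (G_seq lam0 s 2 ** B_mat) *v v"
  shows "u \<bullet> (A_block \<Sigma> lam0 n P 1 1 *v u) + 2 * (v \<bullet> (A_block \<Sigma> lam0 n P 2 1 *v u)) +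
      v \<bullet> (A_block \<Sigma> lam0 n P 2 2 *v v) =
    real n * ((\<Sum>s\<in>UNIV. P s * (w lam0 u v s \<bullet> (B_tilde \<Sigma> *v w lam0 u v s))) -
      (\<Sum>s\<in>UNIV. P s *\<^sub>R w lam0 u v s) \<bullet> (B_tilde \<Sigma> *v (\<Sum>s\<in>UNIV. P s *\<^sub>R w lam0 u v s)))"
proof -
  let ?C = "B_tilde \<Sigma>"
  have sq: "(a + b) \<bullet> (?C *v (a + b)) = a \<bullet> (?C *v a) + 2 * (b \<bullet> (?C *v a)) + b \<bullet> (?C *v b)" for a b
    using symmetric_inner[OF transpose_B_tilde[OF \<Sigma>], of a b]
    by (simp add: matrix_vector_right_distrib inner_add inner_commute)
  have mean: "(\<Sum>s\<in>UNIV. P s *\<^sub>R w lam0 u v s) = G_design lam0 P 1 *v u + G_design lam0 P 2 *v v"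
    by (simp add: w_def G_design_mult_vec scaleR_right_distrib sum.distrib)
  show ?thesis
    unfolding mean sq inner_A_block inner_A_hat
    by (simp add: w_def sq sum.distrib sum_distrib_left distrib_left right_diff_distrib ac_simps)
qed

lemma A_block_nonneg:
  assumes \<Sigma>: "transpose \<Sigma> = \<Sigma>" "positive_definite \<Sigma>" and "approx_design P"
  shows "0 \<le> u \<bullet> (A_block \<Sigma> lam0 n P 1 1 *v u) + 2 * (v \<bullet> (A_block \<Sigma> lam0 n P 2 1 *v u)) +
      v \<bullet> (A_block \<Sigma> lam0 n P 2 2 *v v)"
  unfolding A_block_quadratic_form[OF \<Sigma>]
  using assms(3) unfolding approx_design_def
  by (intro mult_nonneg_nonneg) (auto intro!: form_mean_le transpose_B_tilde B_tilde_nonneg \<Sigma>)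

section \<open>The upper bound for the information of any design\<close>

definition M_seq ::
  "real^'p::{finite,linorder}^'p::{finite,linorder} \<Rightarrow> real \<Rightarrow> real \<Rightarrow> ('p \<Rightarrow> 't::finite) \<Rightarrow> real^'t^'t" where
  "M_seq \<Sigma> lam0 x s = A_hat \<Sigma> lam0 s 1 1 + x *\<^sub>R (A_hat \<Sigma> lam0 s 1 2 + A_hat \<Sigma> lam0 s 2 1) +
     x\<^sup>2 *\<^sub>R A_hat \<Sigma> lam0 s 2 2"

text \<open>Writing the form of \<open>M_seq\<close> as a \<open>B_tilde\<close> square makes its
  nonnegativity visible and matches it with the block form at
  \<open>(u, x *\<^sub>R u)\<close>.\<close>

lemma inner_M_seq:
  assumes "transpose \<Sigma> = \<Sigma>" "positive_definite \<Sigma>"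
  defines "w \<equiv> \<lambda>lam0 x s u. (G_seq lam0 s 1 ** B_mat) *v u + x *\<^sub>R ((G_seq lam0 s 2 ** B_mat) *v u)"
  shows "u \<bullet> (M_seq \<Sigma> lam0 x s *v u) = w lam0 x s u \<bullet> (B_tilde \<Sigma> *v w lam0 x s u)"
  by (simp add: M_seq_def w_def matrix_vector_mult_add_rdistrib inner_add inner_A_hat
      matrix_vector_right_distrib matrix_vector_mult_scaleR power2_eq_square algebra_simps
      flip: scaleR_matrix_vector_assoc)

lemma trace_M_seq:
  assumes "transpose \<Sigma> = \<Sigma>" "positive_definite \<Sigma>"
  shows "trace (M_seq \<Sigma> lam0 x s) = r_seq \<Sigma> lam0 s x"
  using trace_transpose[of "A_hat \<Sigma> lam0 s 1 2"]
  by (simp add: M_seq_def trace_add trace_scaleR r_seq_def h_seq_def transpose_A_hat[OF assms])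

text \<open>This turns the trace of \<open>M ** B_mat\<close> in the averaging formula into the
  trace of \<open>M\<close> itself.\<close>

lemma M_seq_mult_B_mat: "M_seq \<Sigma> lam0 x s ** B_mat = M_seq \<Sigma> lam0 x s"
  unfolding M_seq_def
  by (simp add: matrix_add_mult_distrib A_hat_mult_B_mat flip: scalar_matrix_assoc)

lemma r_seq_le_r_max:
  fixes s :: "'p::{finite,linorder} \<Rightarrow> 't::finite"
  shows "r_seq \<Sigma> lam0 s x \<le> r_max TYPE('t) \<Sigma> lam0 x"
  unfolding r_max_def by (intro Max_ge) auto

lemma trace_sum: "trace (\<Sum>s\<in>S. f s) = (\<Sum>s\<in>S. trace (f s :: real^'n^'n))"
  by (induction S rule: infinite_finite_induct) (simp_all add: trace_add trace_0[unfolded mat_0])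

lemma A_info_le:
  assumes \<Sigma>: "transpose \<Sigma> = \<Sigma>" "positive_definite \<Sigma>" and P: "approx_design P"
    and ginv: "\<And>M. generalized_inverse M (ginv M)"
  shows "u \<bullet> (A_info ginv \<Sigma> lam0 n P *v u) \<le>
    u \<bullet> ((real n *\<^sub>R (\<Sum>s\<in>UNIV. P s *\<^sub>R M_seq \<Sigma> lam0 x s)) *v u)"
proof -
  let ?K = "A_block \<Sigma> lam0 n P"
  let ?w = "\<lambda>s. (G_seq lam0 s 1 ** B_mat) *v u + (G_seq lam0 s 2 ** B_mat) *v (x *\<^sub>R u)"
  have "u \<bullet> (A_info ginv \<Sigma> lam0 n P *v u) \<le>
      u \<bullet> (?K 1 1 *v u) + 2 * x * (u \<bullet> (?K 2 1 *v u)) + x\<^sup>2 * (u \<bullet> (?K 2 2 *v u))"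
    unfolding A_info_def
  proof (rule schur_complement_le)
    show "a \<bullet> (?K 1 2 *v b) = (?K 2 1 *v a) \<bullet> b" for a b
      by (metis inner_transpose_mult transpose_A_block[OF \<Sigma>])
  qed (rule A_block_nonneg[OF \<Sigma> P] transpose_A_block[OF \<Sigma>] ginv)+
  also have "\<dots> = u \<bullet> (?K 1 1 *v u) + 2 * ((x *\<^sub>R u) \<bullet> (?K 2 1 *v u)) + (x *\<^sub>R u) \<bullet> (?K 2 2 *v (x *\<^sub>R u))"
    by (simp add: matrix_vector_mult_scaleR power2_eq_square)
  also have "\<dots> \<le> real n * (\<Sum>s\<in>UNIV. P s * (?w s \<bullet> (B_tilde \<Sigma> *v ?w s)))"
    unfolding A_block_quadratic_form[OF \<Sigma>]
    \<comment> \<open>The discarded term is the \<open>B_tilde\<close> form at the mean, which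
      enters with a minus sign.\<close>
    by (intro mult_left_mono) (simp_all add: B_tilde_nonneg[OF \<Sigma>])
  also have "\<dots> = u \<bullet> ((real n *\<^sub>R (\<Sum>s\<in>UNIV. P s *\<^sub>R M_seq \<Sigma> lam0 x s)) *v u)"
    by (simp add: inner_M_seq[OF \<Sigma>] sum_matrix_vector_mult inner_sum_right matrix_vector_mult_scaleR
        flip: scaleR_matrix_vector_assoc)
  finally show ?thesis .
qed

section \<open>The exact information matrix under the optimality conditions\<close>

text \<open>Condition \<open>c3\<close> removes the mean corrections from \<open>A11 + x A12\<close>
  and \<open>A21 + x A22\<close>, so \<open>c1\<close> and \<open>c2\<close> evaluate these. With
  \<open>A12 = A21 = - x A22\<close> the subtracted product is
  \<open>x\<^sup>2 A22 = - x A12\<close> whatever the generalized inverse, which leaves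
  \<open>A11 + x A12\<close>.\<close>

lemma A_info_optimal:
  fixes \<Sigma> :: "real^'p::{finite,linorder}^'p::{finite,linorder}"
    and P :: "('p \<Rightarrow> 't::finite) \<Rightarrow> real"
  assumes \<Sigma>: "transpose \<Sigma> = \<Sigma>" "positive_definite \<Sigma>"
    and ginv: "\<And>M. generalized_inverse M (ginv M)"
    and c1: "(\<Sum>s\<in>UNIV. P s *\<^sub>R (A_hat \<Sigma> lam0 s 1 1 + x *\<^sub>R A_hat \<Sigma> lam0 s 1 2)) = c *\<^sub>R B_mat"
    and c2: "(\<Sum>s\<in>UNIV. P s *\<^sub>R (A_hat \<Sigma> lam0 s 2 1 + x *\<^sub>R A_hat \<Sigma> lam0 s 2 2)) = 0"
    and c3: "(\<Sum>s\<in>UNIV. P s *\<^sub>R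
        (B_tilde \<Sigma> ** (F_mat s + x *\<^sub>R (T_mat s + lam0 *\<^sub>R F_mat s)) ** B_mat)) = 0"
  shows "A_info ginv \<Sigma> lam0 n P = (real n * c) *\<^sub>R B_mat"
proof -
  let ?K = "A_block \<Sigma> lam0 n P"
  let ?G = "G_design lam0 P"
  have "B_tilde \<Sigma> *v (?G 1 *v v) + x *\<^sub>R (B_tilde \<Sigma> *v (?G 2 *v v)) = 0" for v
  proof -
    have "B_tilde \<Sigma> *v (?G 1 *v v) + x *\<^sub>R (B_tilde \<Sigma> *v (?G 2 *v v)) =
      (\<Sum>s\<in>UNIV. P s *\<^sub>R (B_tilde \<Sigma> ** (F_mat s + x *\<^sub>R (T_mat s + lam0 *\<^sub>R F_mat s)) ** B_mat)) *v v"
      by (simp add: G_design_mult_vec G_seq_def sum_matrix_vector_mult matrix_vector_mult_sum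
          matrix_vector_mult_scaleR matrix_vector_right_distrib matrix_vector_mult_add_rdistrib
          scaleR_right_distrib scaleR_sum_right sum.distrib ac_simps
          flip: scaleR_matrix_vector_assoc matrix_vector_mul_assoc)
    then show ?thesis
      unfolding c3 by simp
  qed
  then have zero: "M *v (B_tilde \<Sigma> *v (?G 1 *v v)) + x *\<^sub>R (M *v (B_tilde \<Sigma> *v (?G 2 *v v))) = 0"
    for M :: "real^'p::{finite,linorder}^'t" and v
    by (metis matrix_vector_mult_0_right matrix_vector_mult_scaleR matrix_vector_right_distrib)
  have K: "?K i 1 *v v + x *\<^sub>R (?K i 2 *v v) =
      real n *\<^sub>R ((\<Sum>s\<in>UNIV. P s *\<^sub>R (A_hat \<Sigma> lam0 s i 1 + x *\<^sub>R A_hat \<Sigma> lam0 s i 2)) *v v)" for i v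
  proof -
    have "?K i 1 *v v + x *\<^sub>R (?K i 2 *v v) = real n *\<^sub>R
      ((\<Sum>s\<in>UNIV. P s *\<^sub>R (A_hat \<Sigma> lam0 s i 1 + x *\<^sub>R A_hat \<Sigma> lam0 s i 2)) *v v -
       (transpose (?G i) *v (B_tilde \<Sigma> *v (?G 1 *v v)) +
        x *\<^sub>R (transpose (?G i) *v (B_tilde \<Sigma> *v (?G 2 *v v)))))"
      by (simp add: A_block_mult_vec sum_matrix_vector_mult matrix_vector_mult_add_rdistrib
          scaleR_right_distrib scaleR_right_diff_distrib scaleR_sum_right sum.distrib ac_simps
          del: transpose_matrix_vector flip: scaleR_matrix_vector_assoc)
    then show ?thesis
      unfolding zero by simp
  qed
  have K1: "?K 1 1 *v v + x *\<^sub>R (?K 1 2 *v v) = (real n * c) *\<^sub>R (B_mat *v v)" for v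
    unfolding K c1 by (simp flip: scaleR_matrix_vector_assoc)
  have "?K 2 1 *v v + x *\<^sub>R (?K 2 2 *v v) = 0" for v
    unfolding K c2 by simp
  then have K21: "?K 2 1 *v v = (- x) *\<^sub>R (?K 2 2 *v v)" for v
    by (simp only: scaleR_minus_left eq_neg_iff_add_eq_0)
  then have "?K 2 1 = (- x) *\<^sub>R ?K 2 2"
    by (simp only: matrix_eq scaleR_matrix_vector_assoc simp_thms)
  \<comment> \<open>\<open>A12\<close> is the transpose of \<open>A21\<close>, and
    \<open>A22\<close> is symmetric.\<close>
  then have "?K 1 2 = (- x) *\<^sub>R ?K 2 2"
    using transpose_A_block[OF \<Sigma>] by (metis transpose_scalar)
  then have K12: "?K 1 2 *v v = (- x) *\<^sub>R (?K 2 2 *v v)" for v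
    by (simp only: scaleR_matrix_vector_assoc)
  have "?K 2 2 ** ginv (?K 2 2) ** ?K 2 2 = ?K 2 2"
    using ginv unfolding generalized_inverse_def .
  then have "?K 2 2 *v (ginv (?K 2 2) *v (?K 2 2 *v v)) = ?K 2 2 *v v" for v
    by (metis matrix_vector_mul_assoc)
  then have "A_info ginv \<Sigma> lam0 n P *v v = ((real n * c) *\<^sub>R B_mat) *v v" for v
    using K1[of v]
    by (simp add: A_info_def K12 K21 matrix_vector_mult_diff_rdistrib matrix_vector_mult_scaleR
        del: scaleR_minus_left One_nat_def flip: matrix_vector_mul_assoc scaleR_matrix_vector_assoc) simp
  then show ?thesis
    by (simp add: matrix_eq)
qed

section \<open>Comparison of an arbitrary design with the given one under an exchangeable
  prior\<close>

theorem corollary4: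
  fixes \<Sigma> :: "real^'p::{finite,linorder}^'p::{finite,linorder}"
    and lam0 x\<^sub>0 y\<^sub>0 :: real
    and n :: nat
    and ginv :: "real^'t::finite^'t \<Rightarrow> real^'t^'t"
    and P :: "('p \<Rightarrow> 't) \<Rightarrow> real"
    and g :: "(real^'t) measure"
  assumes "CARD('p) \<ge> 2" and "CARD('t) \<ge> 2" and "n \<ge> 1"
    and "transpose \<Sigma> = \<Sigma>" and "positive_definite \<Sigma>"
    and ginv: "\<And>M. generalized_inverse M (ginv M)"
    and y0_min: "y\<^sub>0 \<in> range (r_max TYPE('t) \<Sigma> lam0)" "\<And>x. y\<^sub>0 \<le> r_max TYPE('t) \<Sigma> lam0 x"
    and x0_unique: "\<And>x. r_max TYPE('t) \<Sigma> lam0 x = y\<^sub>0 \<longleftrightarrow> x = x\<^sub>0"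
    and "approx_design P"
    and "(\<Sum>s\<in>R_set \<Sigma> lam0 x\<^sub>0 y\<^sub>0. P s *\<^sub>R (A_hat \<Sigma> lam0 s 1 1 + x\<^sub>0 *\<^sub>R A_hat \<Sigma> lam0 s 1 2))
           = (y\<^sub>0 / (real CARD('t) - 1)) *\<^sub>R B_mat"
    and "(\<Sum>s\<in>R_set \<Sigma> lam0 x\<^sub>0 y\<^sub>0. P s *\<^sub>R (A_hat \<Sigma> lam0 s 2 1 + x\<^sub>0 *\<^sub>R A_hat \<Sigma> lam0 s 2 2)) = 0"
    and "(\<Sum>s\<in>R_set \<Sigma> lam0 x\<^sub>0 y\<^sub>0. P s *\<^sub>R
            (B_tilde \<Sigma> ** (F_mat s + x\<^sub>0 *\<^sub>R (T_mat s + lam0 *\<^sub>R F_mat s)) ** B_mat)) = 0"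
    and "(\<Sum>s\<in>R_set \<Sigma> lam0 x\<^sub>0 y\<^sub>0. P s) = 1"
    and "\<And>s. s \<notin> R_set \<Sigma> lam0 x\<^sub>0 y\<^sub>0 \<Longrightarrow> P s = 0"
    and "prior g" and "exchangeable g"
  shows "\<forall>Q :: ('p \<Rightarrow> 't) \<Rightarrow> real. approx_design Q \<longrightarrow> phi ginv \<Sigma> n g lam0 Q \<le> phi ginv \<Sigma> n g lam0 P"
proof (intro allI impI)
  fix Q :: "('p \<Rightarrow> 't) \<Rightarrow> real"
  assume Q: "approx_design Q"
  note t = \<open>CARD('t) \<ge> 2\<close> and \<Sigma> = \<open>transpose \<Sigma> = \<Sigma>\<close> \<open>positive_definite \<Sigma>\<close>
  let ?c = "y\<^sub>0 / (real CARD('t) - 1)"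
  \<comment> \<open>The weights vanish outside \<open>R_set\<close>, so the conditions extend to
    sums over all sequences.\<close>
  have R: "(\<Sum>s\<in>R_set \<Sigma> lam0 x\<^sub>0 y\<^sub>0. P s *\<^sub>R f s) = (\<Sum>s\<in>UNIV. P s *\<^sub>R f s)"
    for f :: "_ \<Rightarrow> 'z::real_vector"
    using assms(15) by (intro sum.mono_neutral_left) auto
  have AP: "A_info ginv \<Sigma> lam0 n P = (real n * ?c) *\<^sub>R B_mat"
    using assms(11-13) unfolding R by (rule A_info_optimal[OF \<Sigma> ginv])
  define M where "M = real n *\<^sub>R (\<Sum>s\<in>UNIV. Q s *\<^sub>R M_seq \<Sigma> lam0 x\<^sub>0 s)"
  have "trace M = real n * (\<Sum>s\<in>UNIV. Q s * r_seq \<Sigma> lam0 s x\<^sub>0)"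
    by (simp add: M_def trace_scaleR trace_sum trace_M_seq[OF \<Sigma>])
  also have "\<dots> \<le> real n * (\<Sum>s\<in>UNIV. Q s * y\<^sub>0)"
    \<comment> \<open>Uniqueness, read at the point itself, says that \<open>r_max\<close> takes the
      value \<open>y\<^sub>0\<close> at \<open>x\<^sub>0\<close>, which bounds every
      \<open>r_seq\<close> there.\<close>
    using Q r_seq_le_r_max[of \<Sigma> lam0 _ x\<^sub>0] x0_unique[of x\<^sub>0] unfolding approx_design_def
    by (intro mult_left_mono sum_mono) auto
  also have "\<dots> = real n * y\<^sub>0"
    using Q by (simp add: approx_design_def flip: sum_distrib_right)
  finally have trM: "trace M \<le> real n * y\<^sub>0" .
  have MB: "M ** B_mat = M"
    unfolding M_def
    by (simp add: sum_matrix_mult M_seq_mult_B_mat flip: scalar_matrix_assoc)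
  have M: "0 \<le> v \<bullet> (M *v v)" for v
    using Q unfolding M_def approx_design_def
    by (auto simp: sum_matrix_vector_mult inner_sum_right inner_M_seq[OF \<Sigma>] B_tilde_nonneg[OF \<Sigma>]
        intro!: sum_nonneg mult_nonneg_nonneg simp flip: scaleR_matrix_vector_assoc)
  have "phi ginv \<Sigma> n g lam0 Q \<le> (\<integral>\<^sup>+ v. ennreal (v \<bullet> (M *v v)) \<partial>g)"
    unfolding phi_def M_def by (intro nn_integral_mono ennreal_leI A_info_le \<Sigma> Q ginv)
  also have "\<dots> = (\<integral>\<^sup>+ v. ennreal (trace M / (real CARD('t) - 1) * (v \<bullet> v)) \<partial>g)"
    using nn_integral_exchangeable_quadratic_form[OF t assms(16,17) M] unfolding MB .
  also have "\<dots> \<le> (\<integral>\<^sup>+ v. ennreal (real n * ?c * (v \<bullet> v)) \<partial>g)"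
    using trM t by (intro nn_integral_mono ennreal_leI mult_right_mono) (auto simp: divide_right_mono)
  also have "\<dots> = phi ginv \<Sigma> n g lam0 P"
    \<comment> \<open>Almost every \<open>v\<close> sums to zero and is therefore fixed by
      \<open>B_mat\<close>, so the information of \<open>P\<close> is the multiple of
      \<open>v \<bullet> v\<close> just reached.\<close>
    using \<open>prior g\<close> unfolding phi_def AP prior_def
    by (intro nn_integral_cong_AE) (auto simp: B_mat_mult_vec elim!: eventually_mono
        simp flip: scaleR_matrix_vector_assoc)
  finally show "phi ginv \<Sigma> n g lam0 Q \<le> phi ginv \<Sigma> n g lam0 P" .
qed

end
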